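(* Let $(G,\precsim)$ be a C-quasi-ordered group. The C-quasi-order $\precsim$ is order-type if and only if there exists a subset $G^+$ of $G$ such that the following holds: (i) $G=G^+\sqcup G^-\sqcup\{1\}$ (disjoint unions), where $G^-:=\{g^{-1}\mid g\in G^+\}$; (ii) $1\precnsim G^-\precnsim G^+$; (iii) $\precsim$ is trivial on $G^-$ (i.e. $a\sim b$ for all $a,b\in G^-$) and coincides with an order $\leq$ on $G^+$.
   Context: A quasi-order is a reflexive, transitive and total binary relation $\precsim$; $a\sim b$ means $a\precsim b\precsim a$, and $a\precnsim b$ means $a\precsim b$ and $a\nsim b$. For subsets, $S\precnsim T$ means $s\precnsim t$ for all $s\in S$, $t\in T$ (a single element stands for its singleton). A C-relation on a set is a ternary relation $C$ such that for all $x,y,z,w$: $C(x,y,z)\Rightarrow C(x,z,y)$; $C(x,y,z)\Rightarrow\neg C(y,x,z)$; $C(x,y,z)\Rightarrow C(w,y,z)\vee C(x,w,z)$; $x\neq y\Rightarrow C(x,y,y)$. On a group it is compatible if $C(x,y,z)$ implies $C(vxu,vyu,vzu)$ for all $x,y,z,u,v$. A C-quasi-order on a group $G$ is a quasi-order of the form $x\precsim y\Leftrightarrow\neg C(x,y,1)$ with $C$ a compatible C-relation (which is then unique: $C(x,y,z)\Leftrightarrow yz^{-1}\precnsim xz^{-1}$); a C-quasi-ordered group is a group with a C-quasi-order. The C-quasi-order is order-type if its C-relation is of the form $C(x,y,z)\Leftrightarrow(y<x\wedge z<x)\vee(y=z\neq x)$ for some total order $\leq$ making $G$ an ordered group, i.e.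 $x\leq y$ implies $xz\leq yz$ and $zx\leq zy$. *)

theory Defs
  imports "HOL-Algebra.Group"
begin

definition quasi_order_on :: "'a set \<Rightarrow> 'a rel \<Rightarrow> bool" where
  "quasi_order_on A Q \<longleftrightarrow> preorder_on A Q \<and> total_on A Q"

definition qequiv :: "'a rel \<Rightarrow> 'a \<Rightarrow> 'a \<Rightarrow> bool" where
  "qequiv Q a b \<longleftrightarrow> (a, b) \<in> Q \<and> (b, a) \<in> Q"

definition qless :: "'a rel \<Rightarrow> 'a \<Rightarrow> 'a \<Rightarrow> bool" where
  "qless Q a b \<longleftrightarrow> (a, b) \<in> Q \<and> \<not> qequiv Q a b"

definition qless_set :: "'a rel \<Rightarrow> 'a set \<Rightarrow> 'a set \<Rightarrow> bool" where
  "qless_set Q S T \<longleftrightarrow> (\<forall>s\<in>S. \<forall>t\<in>T. qless Q s t)"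

definition C_relation_on :: "'a set \<Rightarrow> ('a \<Rightarrow> 'a \<Rightarrow> 'a \<Rightarrow> bool) \<Rightarrow> bool" where
  "C_relation_on A C \<longleftrightarrow>
     (\<forall>x\<in>A. \<forall>y\<in>A. \<forall>z\<in>A. C x y z \<longrightarrow> C x z y) \<and>
     (\<forall>x\<in>A. \<forall>y\<in>A. \<forall>z\<in>A. C x y z \<longrightarrow> \<not> C y x z) \<and>
     (\<forall>x\<in>A. \<forall>y\<in>A. \<forall>z\<in>A. \<forall>w\<in>A. C x y z \<longrightarrow> C w y z \<or> C x w z) \<and>
     (\<forall>x\<in>A. \<forall>y\<in>A. x \<noteq> y \<longrightarrow> C x y y)"

definition compatible_C_relation ::
    "('a, 'b) monoid_scheme \<Rightarrow> ('a \<Rightarrow> 'a \<Rightarrow> 'a \<Rightarrow> bool) \<Rightarrow> bool" where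
  "compatible_C_relation G C \<longleftrightarrow>
     C_relation_on (carrier G) C \<and>
     (\<forall>x\<in>carrier G. \<forall>y\<in>carrier G. \<forall>z\<in>carrier G. \<forall>u\<in>carrier G. \<forall>v\<in>carrier G.
        C x y z \<longrightarrow>
        C (v \<otimes>\<^bsub>G\<^esub> x \<otimes>\<^bsub>G\<^esub> u) (v \<otimes>\<^bsub>G\<^esub> y \<otimes>\<^bsub>G\<^esub> u) (v \<otimes>\<^bsub>G\<^esub> z \<otimes>\<^bsub>G\<^esub> u))"

definition induces_quasi_order ::
    "('a, 'b) monoid_scheme \<Rightarrow> ('a \<Rightarrow> 'a \<Rightarrow> 'a \<Rightarrow> bool) \<Rightarrow> 'a rel \<Rightarrow> bool" where
  "induces_quasi_order G C Q \<longleftrightarrow>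
     (\<forall>x\<in>carrier G. \<forall>y\<in>carrier G. (x, y) \<in> Q \<longleftrightarrow> \<not> C x y \<one>\<^bsub>G\<^esub>)"

definition C_quasi_order :: "('a, 'b) monoid_scheme \<Rightarrow> 'a rel \<Rightarrow> bool" where
  "C_quasi_order G Q \<longleftrightarrow>
     quasi_order_on (carrier G) Q \<and>
     (\<exists>C. compatible_C_relation G C \<and> induces_quasi_order G C Q)"

definition ordered_group_order :: "('a, 'b) monoid_scheme \<Rightarrow> 'a rel \<Rightarrow> bool" where
  "ordered_group_order G R \<longleftrightarrow>
     linear_order_on (carrier G) R \<and>
     (\<forall>x\<in>carrier G. \<forall>y\<in>carrier G. \<forall>z\<in>carrier G. (x, y) \<in> R \<longrightarrow>
        (x \<otimes>\<^bsub>G\<^esub> z, y \<otimes>\<^bsub>G\<^esub> z) \<in> R \<and> (z \<otimes>\<^bsub>G\<^esub> x, z \<otimes>\<^bsub>G\<^esub> y) \<in> R)"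

definition order_C :: "'a rel \<Rightarrow> 'a \<Rightarrow> 'a \<Rightarrow> 'a \<Rightarrow> bool" where
  "order_C R x y z \<longleftrightarrow>
     ((y, x) \<in> R \<and> y \<noteq> x \<and> (z, x) \<in> R \<and> z \<noteq> x) \<or> (y = z \<and> z \<noteq> x)"

text \<open>On the carrier, a compatible C-relation is determined by the quasi-order it induces
  (translate the third argument to the identity), so quantifying over C existentially
  below refers to the C-relation of \<open>Q\<close>.\<close>

definition order_type :: "('a, 'b) monoid_scheme \<Rightarrow> 'a rel \<Rightarrow> bool" where
  "order_type G Q \<longleftrightarrow>
     (\<exists>C. compatible_C_relation G C \<and> induces_quasi_order G C Q \<and>
        (\<exists>R. ordered_group_order G R \<and>
           (\<forall>x\<in>carrier G. \<forall>y\<in>carrier G. \<forall>z\<in>carrier G. C x y z \<longleftrightarrow> order_C R x y z)))"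

definition inverse_set :: "('a, 'b) monoid_scheme \<Rightarrow> 'a set \<Rightarrow> 'a set" where
  "inverse_set G P = {inv\<^bsub>G\<^esub> g | g. g \<in> P}"

end

theory Submission
  imports Defs
begin

text \<open>If \<open>C\<close> is the C-relation of \<open>Q\<close>, then \<open>y\<close> lies strictly below \<open>x\<close> iff \<open>C x y \<one>\<close>. Given
  \<open>Gp\<close>, the elements of \<open>Gp\<close> are exactly those above some element of \<open>Gm\<close>. Translating \<open>C x y \<one>\<close>
  by \<open>y\<inverse>\<close> gives \<open>C (x y\<inverse>) y\<inverse> \<one>\<close>, which
  shows both that \<open>Gp\<close> is closed under products and that \<open>Q\<close> restricted to \<open>Gp\<close> is the order with
  positive cone \<open>Gp\<close>. Invariance of \<open>Gp\<close> under conjugation follows because \<open>p \<in> Gp\<close> iff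
  \<open>p\<inverse>\<close> lies strictly below \<open>p\<close>.\<close>

text \<open>Totality of \<open>Q\<close> makes the failure of \<open>(x, y) \<in> Q\<close> the same
  as strict descent from \<open>x\<close> to \<open>y\<close>, so strict comparisons can be read off
  \<open>C\<close> with third argument \<open>\<one>\<close>.\<close>

lemma qless_iff_C:
  assumes "quasi_order_on (carrier G) Q" "induces_quasi_order G C Q"
    and "x \<in> carrier G" "y \<in> carrier G"
  shows "qless Q y x \<longleftrightarrow> C x y \<one>\<^bsub>G\<^esub>"
proof -
  have "(x, y) \<in> Q \<or> (y, x) \<in> Q"
    using assms by (cases "x = y") (auto simp: quasi_order_on_def preorder_on_def total_on_def refl_on_def)
  then show ?thesis
    using assms by (auto simp: qless_def qequiv_def induces_quasi_order_def)
qed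

text \<open>The usual order with strict positive cone \<open>P\<close>. With the quotient taken as
  \<open>y \<otimes> inv x\<close>, right translations leave it unchanged and left translations
  conjugate it.\<close>

definition cone_order :: "('a, 'b) monoid_scheme \<Rightarrow> 'a set \<Rightarrow> 'a rel" where
  "cone_order G P = {(x, y). x \<in> carrier G \<and> y \<in> carrier G \<and> (x = y \<or> y \<otimes>\<^bsub>G\<^esub> inv\<^bsub>G\<^esub> x \<in> P)}"

section \<open>Ordered groups from positive cones, and translation of C-relations\<close>

context group
begin

lemma mult_inv_cancel_middle:
  assumes "x \<in> carrier G" "y \<in> carrier G" "z \<in> carrier G"
  shows "(x \<otimes> inv y) \<otimes> (y \<otimes> z) = x \<otimes> z"
  using assms by (metis inv_closed inv_solve_left m_assoc m_closed)

lemma mult_inv_translate: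
  assumes "x \<in> carrier G" "y \<in> carrier G" "z \<in> carrier G"
  shows "(x \<otimes> z) \<otimes> inv (y \<otimes> z) = x \<otimes> inv y"
  using assms by (simp add: inv_mult_group m_assoc[symmetric] inv_solve_right')

text \<open>Closure under products gives transitivity and, with \<open>\<one> \<notin> P\<close>,
  antisymmetry; the trichotomy applied to \<open>y \<otimes> inv x\<close> gives totality;
  conjugation invariance is what left translation requires.\<close>

lemma ordered_group_order_cone:
  assumes P: "P \<subseteq> carrier G" "\<one> \<notin> P"
    and total: "\<And>x. x \<in> carrier G \<Longrightarrow> x \<in> P \<or> inv x \<in> P \<or> x = \<one>"
    and mult: "\<And>x y. x \<in> P \<Longrightarrow> y \<in> P \<Longrightarrow> x \<otimes> y \<in> P"
    and conj: "\<And>x g. x \<in> P \<Longrightarrow> g \<in> carrier G \<Longrightarrow> g \<otimes> x \<otimes> inv g \<in> P"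
  shows "ordered_group_order G (cone_order G P)"
proof -
  let ?R = "cone_order G P"
  have tr: "z \<otimes> inv x \<in> P" if "x \<in> carrier G" "y \<in> carrier G" "z \<in> carrier G"
      "y \<otimes> inv x \<in> P" "z \<otimes> inv y \<in> P" for x y z
    using mult[OF that(5,4)] that by (simp add: mult_inv_cancel_middle)
  have irr: "x \<otimes> inv x \<notin> P" if "x \<in> carrier G" for x
    using that P by simp
  have "refl_on (carrier G) ?R" "?R \<subseteq> carrier G \<times> carrier G"
    by (auto simp: refl_on_def cone_order_def)
  moreover have "trans ?R"
    using tr by (auto simp: trans_def cone_order_def)
  moreover have "antisym ?R"
    using tr irr unfolding antisym_def cone_order_def by blast
  moreover have "total_on (carrier G) ?R"
  proof (rule total_onI)
    fix x y assume xy: "x \<in> carrier G" "y \<in> carrier G" "x \<noteq> y"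
    have "inv (y \<otimes> inv x) = x \<otimes> inv y" using xy by (simp add: inv_mult_group)
    moreover have "y \<otimes> inv x \<noteq> \<one>" using xy by (metis inv_closed inv_equality inv_inv)
    ultimately show "(x, y) \<in> ?R \<or> (y, x) \<in> ?R"
      using xy total[of "y \<otimes> inv x"] by (auto simp: cone_order_def)
  qed
  ultimately have "linear_order_on (carrier G) ?R"
    by (simp add: linear_order_on_def partial_order_on_def preorder_on_def)
  moreover have "(x \<otimes> z, y \<otimes> z) \<in> ?R \<and> (z \<otimes> x, z \<otimes> y) \<in> ?R"
    if "x \<in> carrier G" "y \<in> carrier G" "z \<in> carrier G" "(x, y) \<in> ?R" for x y z
  proof -
    have "(z \<otimes> y) \<otimes> inv (z \<otimes> x) = z \<otimes> (y \<otimes> inv x) \<otimes> inv z"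
      using that by (simp add: inv_mult_group m_assoc)
    then show ?thesis
      using that conj[of "y \<otimes> inv x" z] by (auto simp: cone_order_def mult_inv_translate)
  qed
  ultimately show ?thesis by (simp add: ordered_group_order_def)
qed

lemma ordered_group_order_inv:
  assumes "ordered_group_order G R" "x \<in> carrier G"
  shows "(\<one>, inv x) \<in> R \<longleftrightarrow> (x, \<one>) \<in> R"
proof -
  have t: "(a \<otimes> c, b \<otimes> c) \<in> R" if "(a, b) \<in> R" "a \<in> carrier G" "b \<in> carrier G" "c \<in> carrier G" for a b c
    using assms that by (auto simp: ordered_group_order_def)
  show ?thesis
    using t[of \<one> "inv x" x] t[of x \<one> "inv x"] assms(2) by auto
qed

text \<open>Compatibility gives one direction, and translating back by \<open>inv u\<close> the
  other. Taking \<open>u\<close> to be the inverse of an argument moves that argument to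
  \<open>\<one>\<close>.\<close>

lemma compatible_C_mult_right_iff:
  assumes "compatible_C_relation G C"
    and xyz: "x \<in> carrier G" "y \<in> carrier G" "z \<in> carrier G" and u: "u \<in> carrier G"
  shows "C (x \<otimes> u) (y \<otimes> u) (z \<otimes> u) \<longleftrightarrow> C x y z"
proof -
  have t: "C (a \<otimes> w) (b \<otimes> w) (c \<otimes> w)"
    if "C a b c" "a \<in> carrier G" "b \<in> carrier G" "c \<in> carrier G" "w \<in> carrier G" for a b c w
  proof -
    have "C (\<one> \<otimes> a \<otimes> w) (\<one> \<otimes> b \<otimes> w) (\<one> \<otimes> c \<otimes> w)"
      using assms(1) that one_closed unfolding compatible_C_relation_def by blast
    then show ?thesis using that by simp
  qed
  show ?thesis
    using t[of "x \<otimes> u" "y \<otimes> u" "z \<otimes> u" "inv u"] t[of x y z u] xyz u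
    by (auto simp: m_assoc)
qed

section \<open>From an order-type C-quasi-order to its positive part\<close>

text \<open>The witness is the set of strictly positive elements of the group order
  \<open>R\<close>. Each property then follows by evaluating \<open>order_C R x y \<one>\<close>
  according to the signs of \<open>x\<close> and \<open>y\<close>.\<close>

lemma positive_part_of_order_type:
  assumes Q: "quasi_order_on (carrier G) Q" and ot: "order_type G Q"
  obtains P where "P \<subseteq> carrier G" "carrier G = P \<union> inverse_set G P \<union> {\<one>}"
    "P \<inter> inverse_set G P = {}" "\<one> \<notin> P" "\<one> \<notin> inverse_set G P"
    "qless_set Q {\<one>} (inverse_set G P)" "qless_set Q (inverse_set G P) P"
    "\<forall>a\<in>inverse_set G P. \<forall>b\<in>inverse_set G P. qequiv Q a b"
    "\<exists>R. linear_order_on P R \<and> (\<forall>a\<in>P. \<forall>b\<in>P. (a, b) \<in> Q \<longleftrightarrow> (a, b) \<in> R)"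
proof -
  obtain C R where ind: "induces_quasi_order G C Q" and R: "ordered_group_order G R"
    and C: "\<And>x y z. x \<in> carrier G \<Longrightarrow> y \<in> carrier G \<Longrightarrow> z \<in> carrier G \<Longrightarrow> C x y z \<longleftrightarrow> order_C R x y z"
    using ot by (auto simp: order_type_def)
  have lin: "linear_order_on (carrier G) R"
    using R by (simp add: ordered_group_order_def)
  have asym: "x = y" if "(x, y) \<in> R" "(y, x) \<in> R" for x y
    using lin that by (auto simp: linear_order_on_def partial_order_on_def antisym_def)
  have tot: "(x, y) \<in> R \<or> (y, x) \<in> R" if "x \<in> carrier G" "y \<in> carrier G" for x y
    using lin that
    by (cases "x = y")
      (auto simp: linear_order_on_def partial_order_on_def preorder_on_def refl_on_def total_on_def)
  have tr: "(x, z) \<in> R" if "(x, y) \<in> R" "(y, z) \<in> R" for x y z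
    using lin that
    by (auto simp: linear_order_on_def partial_order_on_def preorder_on_def dest: transD)
  define P where "P = {g \<in> carrier G. (\<one>, g) \<in> R \<and> g \<noteq> \<one>}"
  define N where "N = {g \<in> carrier G. (g, \<one>) \<in> R \<and> g \<noteq> \<one>}"
  have inv_P: "inv g \<in> N" if "g \<in> P" for g
    using that ordered_group_order_inv[OF R, of "inv g"] by (auto simp: P_def N_def)
  have inv_N: "inv g \<in> P" if "g \<in> N" for g
    using that ordered_group_order_inv[OF R, of g] by (auto simp: P_def N_def)
  have N: "inverse_set G P = N"
  proof
    show "inverse_set G P \<subseteq> N" using inv_P by (auto simp: inverse_set_def)
    show "N \<subseteq> inverse_set G P"
    proof
      fix g assume "g \<in> N"
      then have "g = inv (inv g)" by (simp add: N_def)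
      with inv_N[OF \<open>g \<in> N\<close>] show "g \<in> inverse_set G P"
        unfolding inverse_set_def by blast
    qed
  qed
  have Q_iff: "(x, y) \<in> Q \<longleftrightarrow> \<not> order_C R x y \<one>" if "x \<in> carrier G" "y \<in> carrier G" for x y
    using ind C that by (simp add: induces_quasi_order_def)
  have less_iff: "qless Q y x \<longleftrightarrow> order_C R x y \<one>" if "x \<in> carrier G" "y \<in> carrier G" for x y
    using qless_iff_C[OF Q ind that] C that by simp
  \<comment> \<open>Unfolding with \<open>N\<close> replaces the set of inverses by the strictly
    negative elements, so that only signs matter below.\<close>
  show ?thesis
  proof (rule that[of P, unfolded N])
    show "P \<subseteq> carrier G" "\<one> \<notin> P" "\<one> \<notin> N" by (auto simp: P_def N_def)
    show "carrier G = P \<union> N \<union> {\<one>}"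
      using tot[of _ \<one>] by (auto simp: P_def N_def)
    show "P \<inter> N = {}" using asym by (auto simp: P_def N_def)
    show "qless_set Q {\<one>} N"
      by (auto simp: qless_set_def less_iff N_def order_C_def)
    show "qless_set Q N P"
      unfolding qless_set_def
    proof (intro ballI)
      fix n p assume "n \<in> N" "p \<in> P"
      moreover from this have "n \<noteq> p" "(n, p) \<in> R" using asym tr by (auto simp: N_def P_def)
      ultimately show "qless Q n p" by (auto simp: less_iff N_def P_def order_C_def)
    qed
    \<comment> \<open>For negative \<open>a\<close> and \<open>b\<close>, the first disjunct of
      \<open>order_C R a b \<one>\<close> would make \<open>a\<close> positive and the second would
      force \<open>b = \<one>\<close>.\<close>
    show "\<forall>a\<in>N. \<forall>b\<in>N. qequiv Q a b"
      using asym by (auto simp: qequiv_def Q_iff N_def order_C_def)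
    have "linear_order_on P (R \<inter> P \<times> P)"
      using lin tr asym tot unfolding linear_order_on_def partial_order_on_def preorder_on_def
      by (auto simp: refl_on_def total_on_def antisym_def P_def intro!: transI)
    moreover have "\<forall>a\<in>P. \<forall>b\<in>P. (a, b) \<in> Q \<longleftrightarrow> (a, b) \<in> R \<inter> P \<times> P"
    proof (intro ballI)
      fix a b assume ab: "a \<in> P" "b \<in> P"
      \<comment> \<open>Both elements are positive, so the conjunct on \<open>\<one>\<close> is
        automatic and the second disjunct of \<open>order_C\<close> fails.\<close>
      then have "(a, b) \<in> Q \<longleftrightarrow> \<not> ((b, a) \<in> R \<and> b \<noteq> a)"
        by (auto simp: Q_iff P_def order_C_def)
      also have "\<dots> \<longleftrightarrow> (a, b) \<in> R"
        using ab asym tot[of a b] by (auto simp: P_def)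
      finally show "(a, b) \<in> Q \<longleftrightarrow> (a, b) \<in> R \<inter> P \<times> P" using ab by simp
    qed
    ultimately show "\<exists>R. linear_order_on P R \<and> (\<forall>a\<in>P. \<forall>b\<in>P. (a, b) \<in> Q \<longleftrightarrow> (a, b) \<in> R)"
      by blast
  qed
qed

section \<open>From a positive part to the group order\<close>

text \<open>Once \<open>P\<close> is known to be a positive cone, \<open>C x y \<one>\<close> is
  computed from the position of \<open>x\<close> and \<open>y\<close> in the partition, and
  translation by \<open>inv z\<close> carries the formula to all triples.\<close>

lemma order_type_of_positive_part:
  assumes cqo: "C_quasi_order G Q"
    and P: "P \<subseteq> carrier G" and N: "N = inverse_set G P"
    and cover: "carrier G = P \<union> N \<union> {\<one>}"
    and one: "\<one> \<notin> P"
    and N_P: "qless_set Q N P"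
    and NN: "\<forall>a\<in>N. \<forall>b\<in>N. qequiv Q a b"
  shows "order_type G Q"
proof -
  obtain C where Q: "quasi_order_on (carrier G) Q"
    and comp: "compatible_C_relation G C" and ind: "induces_quasi_order G C Q"
    using cqo by (auto simp: C_quasi_order_def)
  have less_iff: "qless Q y x \<longleftrightarrow> C x y \<one>" if "x \<in> carrier G" "y \<in> carrier G" for x y
    using qless_iff_C[OF Q ind that] .
  have swap: "C x y z \<longleftrightarrow> C x z y" if "x \<in> carrier G" "y \<in> carrier G" "z \<in> carrier G" for x y z
    using comp that unfolding compatible_C_relation_def C_relation_on_def by blast
  have C1: "C x \<one> \<one>" if "x \<in> carrier G" "x \<noteq> \<one>" for x
    using comp that one_closed unfolding compatible_C_relation_def C_relation_on_def by blast
  have asym: "\<not> C y x \<one>" if "C x y \<one>" "x \<in> carrier G" "y \<in> carrier G" for x y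
    using comp that one_closed unfolding compatible_C_relation_def C_relation_on_def by blast
  have PG: "x \<in> carrier G" if "x \<in> P" for x using P that by blast
  have NG: "x \<in> carrier G" if "x \<in> N" for x using cover that by blast
  have inv_P: "inv x \<in> N" if "x \<in> P" for x using that by (auto simp: N inverse_set_def)
  have inv_N: "inv x \<in> P" if "x \<in> N" for x using that P by (auto simp: N inverse_set_def)
  have C_PN: "C p n \<one>" if "p \<in> P" "n \<in> N" for p n
    using N_P that PG NG by (simp add: qless_set_def less_iff)
  have C_NN: "\<not> C m n \<one>" if "m \<in> N" "n \<in> N" for m n
    using NN that less_iff[of m n] NG by (auto simp: qless_def qequiv_def)
  have C_one: "\<not> C \<one> y \<one>" if "y \<in> carrier G" for y
    using asym C1 that one_closed by metis
  \<comment> \<open>The covering leaves only \<open>N\<close> and \<open>\<one>\<close> to exclude: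
    \<open>C\<close> never holds between two elements of \<open>N\<close>, nor with
    \<open>\<one>\<close> as first and third argument.\<close>
  have above_N: "x \<in> P" if "C x n \<one>" "n \<in> N" "x \<in> carrier G" for x n
    using that cover C_NN C_one NG by blast
  have above_P: "x \<in> P" if "C x p \<one>" "p \<in> P" "x \<in> carrier G" for x p
    using that cover asym C_PN C_one PG by blast
  \<comment> \<open>Translating by \<open>inv y\<close> sends \<open>y\<close> to
    \<open>\<one>\<close> and \<open>\<one>\<close> to \<open>inv y\<close>; symmetry in the last
    two arguments puts \<open>\<one>\<close> back in third place.\<close>
  have shift: "C (x \<otimes> inv y) (inv y) \<one> \<longleftrightarrow> C x y \<one>" if "x \<in> carrier G" "y \<in> carrier G" for x y
    using compatible_C_mult_right_iff[OF comp, of x y \<one> "inv y"]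
      swap[of "x \<otimes> inv y" \<one> "inv y"] that by simp
  have mult: "x \<otimes> y \<in> P" if "x \<in> P" "y \<in> P" for x y
  proof -
    \<comment> \<open>This is the shift of \<open>C x (inv y) \<one>\<close>, which holds because
      \<open>inv y\<close> lies in \<open>N\<close>; hence the product lies above \<open>y\<close>,
      an element of \<open>P\<close>.\<close>
    have "C (x \<otimes> y) y \<one>"
      using shift[of x "inv y"] C_PN[OF that(1) inv_P[OF that(2)]] that PG by simp
    then show ?thesis using above_P that PG by blast
  qed
  have conj: "g \<otimes> x \<otimes> inv g \<in> P" if x: "x \<in> P" and g: "g \<in> carrier G" for x g
  proof (rule ccontr)
    let ?y = "g \<otimes> x \<otimes> inv g"
    have xG: "x \<in> carrier G" using PG x .
    have "C x (inv x) \<one>" using C_PN inv_P x by blast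
    then have "C ?y (g \<otimes> inv x \<otimes> inv g) (g \<otimes> \<one> \<otimes> inv g)"
      using comp xG g inv_closed one_closed unfolding compatible_C_relation_def by blast
    then have C: "C ?y (inv ?y) \<one>"
      using xG g by (simp add: inv_mult_group m_assoc)
    assume "?y \<notin> P"
    moreover have "?y \<noteq> \<one>" using C C_one[of "inv ?y"] xG g by auto
    ultimately have "?y \<in> N" using cover xG g by blast
    \<comment> \<open>If \<open>?y\<close> were in \<open>N\<close>, its inverse would be in
      \<open>P\<close> and so strictly above it, against asymmetry.\<close>
    then show False using C C_PN[OF inv_N] asym NG PG inv_N by blast
  qed
  let ?R = "cone_order G P"
  have R: "ordered_group_order G ?R"
    using P one mult conj cover inv_N by (intro ordered_group_order_cone) auto
  have R_less: "(y, x) \<in> ?R \<and> y \<noteq> x \<longleftrightarrow> x \<otimes> inv y \<in> P" if "x \<in> carrier G" "y \<in> carrier G" for x y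
    using that one by (auto simp: cone_order_def)
  \<comment> \<open>The right-hand side is \<open>order_C ?R x y \<one>\<close> expressed through
    the cone.\<close>
  have base: "C x y \<one> \<longleftrightarrow> (x \<otimes> inv y \<in> P \<and> x \<in> P) \<or> (y = \<one> \<and> x \<noteq> \<one>)"
    if xy: "x \<in> carrier G" "y \<in> carrier G" for x y
  proof -
    consider "x = \<one>" | "y = \<one>" "x \<noteq> \<one>" | "x \<in> N" "y \<in> N" | "x \<in> N" "y \<in> P"
      | "x \<in> P" "y \<in> N" | "x \<in> P" "y \<in> P"
      using xy cover by blast
    then show ?thesis
    proof cases
      case 1
      then show ?thesis using C_one xy one by auto
    next
      case 2
      then show ?thesis using C1 xy by simp
    next
      case 3
      \<comment> \<open>Both sides are false: \<open>x \<in> P\<close> would give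
        \<open>C x x \<one>\<close>, and \<open>y = \<one>\<close> would give
        \<open>C x y \<one>\<close> inside \<open>N\<close>.\<close>
      then show ?thesis using C_NN asym[of x x] C_PN C_one C1 xy by (metis one_closed)
    next
      case 4
      then show ?thesis using C_PN asym C_NN xy one by metis
    next
      case 5
      then show ?thesis using C_PN mult inv_N by blast
    next
      case 6
      \<comment> \<open>After the shift, the comparison is with \<open>inv y \<in> N\<close>, and
        lying above an element of \<open>N\<close> characterises \<open>P\<close>.\<close>
      then have "C x y \<one> \<longleftrightarrow> x \<otimes> inv y \<in> P"
        using shift[OF xy] above_N C_PN inv_P xy by (metis inv_closed m_closed)
      then show ?thesis using 6 one by auto
    qed
  qed
  have "C x y z \<longleftrightarrow> order_C ?R x y z"
    if xyz: "x \<in> carrier G" "y \<in> carrier G" "z \<in> carrier G" for x y z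
  proof -
    have "C x y z \<longleftrightarrow> C (x \<otimes> inv z) (y \<otimes> inv z) \<one>"
      using compatible_C_mult_right_iff[OF comp xyz, of "inv z"] xyz by simp
    \<comment> \<open>The factors \<open>inv z\<close> cancel in the quotient of the two translated
      arguments, leaving \<open>x \<otimes> inv y\<close>.\<close>
    also have "\<dots> \<longleftrightarrow> (x \<otimes> inv y \<in> P \<and> x \<otimes> inv z \<in> P)
        \<or> (y \<otimes> inv z = \<one> \<and> x \<otimes> inv z \<noteq> \<one>)"
      using base[of "x \<otimes> inv z" "y \<otimes> inv z"] xyz by (simp add: mult_inv_translate)
    also have "y \<otimes> inv z = \<one> \<longleftrightarrow> y = z" using xyz by (metis inv_closed inv_equality inv_inv r_inv)
    also have "x \<otimes> inv z = \<one> \<longleftrightarrow> x = z" using xyz by (metis inv_closed inv_equality inv_inv r_inv)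
    finally show ?thesis
      using R_less xyz unfolding order_C_def by blast
  qed
  then show ?thesis using comp ind R unfolding order_type_def by blast
qed

end

theorem proposition2p8:
  fixes G :: "('a, 'b) monoid_scheme" and Q :: "'a rel"
  assumes "group G" and "C_quasi_order G Q"
  shows "order_type G Q \<longleftrightarrow>
    (\<exists>Gp Gm. Gp \<subseteq> carrier G \<and> Gm = inverse_set G Gp \<and>
       (carrier G = Gp \<union> Gm \<union> {\<one>\<^bsub>G\<^esub>} \<and>
          Gp \<inter> Gm = {} \<and> \<one>\<^bsub>G\<^esub> \<notin> Gp \<and> \<one>\<^bsub>G\<^esub> \<notin> Gm) \<and>
       (qless_set Q {\<one>\<^bsub>G\<^esub>} Gm \<and> qless_set Q Gm Gp) \<and>
       ((\<forall>a\<in>Gm. \<forall>b\<in>Gm. qequiv Q a b) \<and>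
          (\<exists>R. linear_order_on Gp R \<and> (\<forall>a\<in>Gp. \<forall>b\<in>Gp. (a, b) \<in> Q \<longleftrightarrow> (a, b) \<in> R))))"
proof -
  interpret group G by fact
  have Q: "quasi_order_on (carrier G) Q" using assms(2) by (simp add: C_quasi_order_def)
  show ?thesis (is "_ \<longleftrightarrow> ?rhs")
  proof
    assume "order_type G Q"
    from positive_part_of_order_type[OF Q this] show ?rhs by metis
  next
    assume ?rhs
    then show "order_type G Q" by (elim exE conjE) (rule order_type_of_positive_part[OF assms(2)])
  qed
qed

end
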